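(* Let $G_1\subset G_2$ be finite subgroups of $\mathrm{SL}(2,\mathbb{C})$, and let $$r\colon\mathrm{Der}_{\mathbb{C}}(\mathbb{C}[u,v],\mathbb{C}[u,v])\to\mathrm{Der}_{\mathbb{C}}(\mathbb{C}[u,v]^{G_2},\mathbb{C}[u,v]),\qquad r(D)=D|_{\mathbb{C}[u,v]^{G_2}}.$$ Then: 1. $r$ is a bijection. 2. $r^{-1}\big(\mathrm{Der}_{\mathbb{C}}(\mathbb{C}[u,v]^{G_2},\mathbb{C}[u,v]^{G_1})\big)$ consists of all $G_1$-equivariant derivations of $\mathbb{C}[u,v]$.
   Context: $\mathrm{SL}(2,\mathbb{C})$ acts on $\mathbb{C}[u,v]$ by algebra automorphisms extending its linear action on $\mathrm{Span}(u,v)=\mathbb{C}^2$. For a commutative algebra $A$ and a commutative $A$-algebra $B$, $\mathrm{Der}_{\mathbb{C}}(A,B)$ is the space of $\mathbb{C}$-linear derivations from $A$ to $B$. Derivations $\mathbb{C}[u,v]^{G_2}\to\mathbb{C}[u,v]^{G_1}$ are regarded as derivations into $\mathbb{C}[u,v]\supset\mathbb{C}[u,v]^{G_1}$. A derivation $D$ of $\mathbb{C}[u,v]$ is $G_1$-equivariant if $gDg^{-1}=D$ for all $g\in G_1$. *)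

theory Defs
  imports
    "HOL-Analysis.Analysis"
    "HOL-Algebra.Group"
    "HOL-Computational_Algebra.Polynomial"
    "HOL-Library.FuncSet"
begin

text \<open>
  The ring \<open>\<complex>[u,v]\<close> is \<open>\<complex>[u][v]\<close>, with \<open>u\<close> the inner and \<open>v\<close> the outer variable.
\<close>

type_synonym cuv = "complex poly poly"

definition cuv_const :: "complex \<Rightarrow> cuv"
  where "cuv_const c = [:[:c:]:]"

definition var_u :: cuv
  where "var_u = [:[:0, 1:]:]"

definition var_v :: cuv
  where "var_v = [:0, 1:]"

text \<open>\<open>cuv_subst x y p\<close> is \<open>p(x, y)\<close>.\<close>

definition cuv_subst :: "cuv \<Rightarrow> cuv \<Rightarrow> cuv \<Rightarrow> cuv"
  where "cuv_subst x y p = poly (map_poly (\<lambda>q. poly (map_poly cuv_const q) x) p) y"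

definition SL2C :: "(complex^2^2) monoid"
  where "SL2C = \<lparr>carrier = {A. det A = 1}, monoid.mult = (**), one = mat 1\<rparr>"

text \<open>
  \<open>u\<close> and \<open>v\<close> are the standard basis vectors of \<open>\<complex>\<^sup>2\<close>, so the image of each is the
  corresponding column of the matrix; with this convention the action is a left action.
\<close>

definition act :: "complex^2^2 \<Rightarrow> cuv \<Rightarrow> cuv"
  where "act g = cuv_subst
    (cuv_const (g$1$1) * var_u + cuv_const (g$2$1) * var_v)
    (cuv_const (g$1$2) * var_u + cuv_const (g$2$2) * var_v)"

definition invariants :: "(complex^2^2) set \<Rightarrow> cuv set"
  where "invariants G = {p. \<forall>g\<in>G. act g p = p}"

text \<open>
  Derivations between subalgebras \<open>A \<subseteq> B\<close> of \<open>\<complex>[u,v]\<close>, where \<open>A\<close> acts on \<open>B\<close> by multiplication.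
  As elements of \<open>A \<rightarrow>\<^sub>E B\<close> they take the value \<open>undefined\<close> outside \<open>A\<close>, so that equality is
  equality of functions on \<open>A\<close>; the inclusion \<open>Der A B \<subseteq> Der A UNIV\<close> is the change of codomain.
\<close>

definition Der :: "cuv set \<Rightarrow> cuv set \<Rightarrow> (cuv \<Rightarrow> cuv) set"
  where "Der A B = {D \<in> A \<rightarrow>\<^sub>E B.
    (\<forall>p\<in>A. \<forall>q\<in>A. D (p + q) = D p + D q) \<and>
    (\<forall>c. \<forall>p\<in>A. D (cuv_const c * p) = cuv_const c * D p) \<and>
    (\<forall>p\<in>A. \<forall>q\<in>A. D (p * q) = p * D q + q * D p)}"

definition equivariant :: "(complex^2^2) set \<Rightarrow> (cuv \<Rightarrow> cuv) \<Rightarrow> bool"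
  where "equivariant G D \<longleftrightarrow> (\<forall>g\<in>G. act g \<circ> D \<circ> act (inv\<^bsub>SL2C\<^esub> g) = D)"

lemma group_SL2C: "group SL2C"
proof (rule groupI)
  fix x assume "x \<in> carrier SL2C"
  then have d: "det x = 1" by (simp add: SL2C_def)
  then have "invertible x" by (simp add: invertible_det_nz)
  then obtain y where y: "x ** y = mat 1" "y ** x = mat 1"
    by (auto simp: invertible_def)
  have "det y = 1" using d det_mul[of y x] y by simp
  then show "\<exists>y\<in>carrier SL2C. y \<otimes>\<^bsub>SL2C\<^esub> x = \<one>\<^bsub>SL2C\<^esub>"
    using y by (auto simp: SL2C_def)
qed (auto simp: SL2C_def det_mul matrix_mul_assoc)

lemma map_poly_mult_hom:
  fixes f :: "'a::comm_ring_1 \<Rightarrow> 'b::comm_ring_1"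
  assumes "f 0 = 0" "\<And>a b. f (a + b) = f a + f b" "\<And>a b. f (a * b) = f a * f b"
  shows "map_poly f (p * q) = map_poly f p * map_poly f q"
proof -
  have add: "map_poly f (p + q) = map_poly f p + map_poly f q" for p q
    by (rule poly_eqI) (simp add: coeff_map_poly assms)
  have sm: "map_poly f (smult a p) = smult (f a) (map_poly f p)" for a p
    by (rule poly_eqI) (simp add: coeff_map_poly assms)
  have pc: "map_poly f (pCons a p) = pCons (f a) (map_poly f p)" for a p
    by (rule poly_eqI) (simp add: coeff_map_poly assms coeff_pCons split: nat.split)
  show ?thesis
    by (induction p) (simp_all add: add sm pc assms)
qed

lemma map_poly_add_hom:
  assumes "f 0 = 0" "\<And>a b. f (a + b) = f a + f b"
  shows "map_poly f (p + q) = map_poly f p + map_poly f q"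
  by (rule poly_eqI) (simp add: coeff_map_poly assms)

lemma cuv_const_hom [simp]:
  "cuv_const 0 = 0" "cuv_const 1 = 1"
  "cuv_const (a + b) = cuv_const a + cuv_const b"
  "cuv_const (a * b) = cuv_const a * cuv_const b"
  by (simp_all add: cuv_const_def one_pCons)

lemma cuv_subst_simps [simp]:
  "cuv_subst x y (p + q) = cuv_subst x y p + cuv_subst x y q"
  "cuv_subst x y (p * q) = cuv_subst x y p * cuv_subst x y q"
  "cuv_subst x y (cuv_const c) = cuv_const c"
  "cuv_subst x y var_u = x"
  "cuv_subst x y var_v = y"
proof -
  let ?f = "\<lambda>q. poly (map_poly cuv_const q) x"
  have f: "?f 0 = 0" "\<And>a b. ?f (a + b) = ?f a + ?f b" "\<And>a b. ?f (a * b) = ?f a * ?f b"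
    by (simp_all add: map_poly_add_hom map_poly_mult_hom)
  show "cuv_subst x y (p + q) = cuv_subst x y p + cuv_subst x y q"
    unfolding cuv_subst_def by (subst map_poly_add_hom) (use f in auto)
  show "cuv_subst x y (p * q) = cuv_subst x y p * cuv_subst x y q"
    unfolding cuv_subst_def by (subst map_poly_mult_hom) (use f in auto)
qed (simp_all add: cuv_subst_def cuv_const_def var_u_def var_v_def map_poly_pCons flip: one_pCons)

lemma cuv_induct:
  assumes "\<And>c. P (cuv_const c)" "P var_u" "P var_v"
    "\<And>p q. P p \<Longrightarrow> P q \<Longrightarrow> P (p + q)" "\<And>p q. P p \<Longrightarrow> P q \<Longrightarrow> P (p * q)"
  shows "P p"
proof -
  have inner: "P [:q:]" for q
  proof (induction q)
    case 0
    show ?case using assms(1)[of 0] by simp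
  next
    case (pCons c q)
    have "[:pCons c q:] = cuv_const c + var_u * [:q:]"
      by (simp add: cuv_const_def var_u_def)
    then show ?case using assms(1)[of c] assms(4) assms(5)[OF assms(2) pCons(2)] by metis
  qed
  show ?thesis
  proof (induction p)
    case 0
    show ?case using assms(1)[of 0] by simp
  next
    case (pCons q p)
    have "pCons q p = [:q:] + var_v * p"
      by (simp add: var_v_def)
    then show ?case using inner[of q] assms(4) assms(5)[OF assms(3) pCons(2)] by metis
  qed
qed

lemma act_simps [simp]:
  "act g (p + q) = act g p + act g q"
  "act g (p * q) = act g p * act g q"
  "act g (cuv_const c) = cuv_const c"
  by (simp_all add: act_def)

lemma act_one: "act (mat 1) p = p"
  by (induction p rule: cuv_induct) (simp_all, simp_all add: act_def mat_def)

lemma act_mult: "act (g ** h) p = act g (act h p)"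
  by (induction p rule: cuv_induct)
    (simp_all, simp_all add: act_def matrix_matrix_mult_def sum_2 algebra_simps)

end

theory Submission
  imports
    Defs
    "HOL-Computational_Algebra.Polynomial_Factorial"
    "HOL-Computational_Algebra.Field_as_Ring"
    "HOL-Computational_Algebra.Fundamental_Theorem_Algebra"
begin

text \<open>
  A derivation of \<open>\<complex>[u,v]\<close> is a vector field \<open>a \<partial>\<^sub>u + b \<partial>\<^sub>v\<close>. Geometrically, the quotient map
  \<open>\<complex>\<^sup>2 \<rightarrow> \<complex>\<^sup>2/G\<close> of a finite subgroup \<open>G\<close> of \<open>SL(2,\<complex>)\<close> is unramified away from the origin,
  because an element of finite order and determinant \<open>1\<close> with eigenvalue \<open>1\<close> is the identity. So
  a derivation \<open>D\<close> of the invariant ring lifts uniquely to a vector field off the origin, and the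
  lift extends over the origin because a point has codimension two.

  In the language of polynomials, write \<open>J(f,g)\<close> for the Jacobian determinant. If \<open>f\<^sub>1\<close>, \<open>f\<^sub>2\<close>
  are invariants with \<open>J(f\<^sub>1,f\<^sub>2) \<noteq> 0\<close>, every polynomial is algebraic over \<open>\<complex>[f\<^sub>1,f\<^sub>2]\<close>, hence a
  derivation of the invariants that kills \<open>f\<^sub>1\<close> and \<open>f\<^sub>2\<close> is zero (\<open>Der_eq_0_if_kills_pair\<close>).
  Applied to Cramer's rule this gives
  \<open>J(f\<^sub>1,f\<^sub>2) D f = A \<partial>\<^sub>u f + B \<partial>\<^sub>v f\<close> for all invariants \<open>f\<close>, where
  \<open>A = D f\<^sub>1 \<partial>\<^sub>v f\<^sub>2 - D f\<^sub>2 \<partial>\<^sub>v f\<^sub>1\<close> and \<open>B = D f\<^sub>2 \<partial>\<^sub>u f\<^sub>1 - D f\<^sub>1 \<partial>\<^sub>u f\<^sub>2\<close>. It remains to divide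
  \<open>A\<close> and \<open>B\<close> by \<open>J(f\<^sub>1,f\<^sub>2)\<close>. The identity shows that \<open>J(f\<^sub>1,f\<^sub>2)\<close> divides \<open>A J(p,q)\<close> and
  \<open>B J(p,q)\<close> for all invariants \<open>p\<close>, \<open>q\<close>; freeness of the action makes the origin the only
  possible common zero of these Jacobians (\<open>jacobian_nonzero_at\<close>), while an irreducible polynomial
  in two variables always has another zero, so no irreducible factor is common to all of them
  and unique factorization gives the division (\<open>dvd_if_dvd_mult_all\<close>).

  Uniqueness of the lift needs a single nonzero Jacobian. The second part follows
  from uniqueness: \<open>D\<close> and \<open>g D g\<^sup>-\<^sup>1\<close> agree on the invariants of \<open>G\<^sub>2\<close> exactly when \<open>D\<close> maps
  these into the elements fixed by \<open>g\<close>, for \<open>g \<in> G\<^sub>1 \<subseteq> G\<^sub>2\<close>.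
\<close>

section \<open>Derivations and partial derivatives\<close>

definition subalgebra :: "cuv set \<Rightarrow> bool"
  where "subalgebra A \<longleftrightarrow> (\<forall>c. cuv_const c \<in> A) \<and>
    (\<forall>p\<in>A. \<forall>q\<in>A. p + q \<in> A) \<and> (\<forall>p\<in>A. \<forall>q\<in>A. p * q \<in> A)"

lemma subalgebraD:
  assumes "subalgebra A"
  shows "cuv_const c \<in> A" "p \<in> A \<Longrightarrow> q \<in> A \<Longrightarrow> p + q \<in> A" "p \<in> A \<Longrightarrow> q \<in> A \<Longrightarrow> p * q \<in> A"
  using assms by (auto simp: subalgebra_def)

lemma subalgebra_0: "subalgebra A \<Longrightarrow> 0 \<in> A"
  using subalgebraD(1)[of A 0] by simp

lemma subalgebra_1: "subalgebra A \<Longrightarrow> 1 \<in> A"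
  using subalgebraD(1)[of A 1] by simp

lemma subalgebra_power: "subalgebra A \<Longrightarrow> p \<in> A \<Longrightarrow> p ^ n \<in> A"
  by (induction n) (auto intro: subalgebra_1 subalgebraD)

lemma subalgebra_sum: "subalgebra A \<Longrightarrow> (\<And>i. i \<in> I \<Longrightarrow> f i \<in> A) \<Longrightarrow> sum f I \<in> A"
  by (induction I rule: infinite_finite_induct) (auto intro: subalgebra_0 subalgebraD)

lemma subalgebra_UNIV: "subalgebra UNIV"
  by (simp add: subalgebra_def)

lemma subalgebra_invariants: "subalgebra (invariants G)"
  by (auto simp: subalgebra_def invariants_def)

lemma DerD:
  assumes "D \<in> Der A B"
  shows "p \<in> A \<Longrightarrow> q \<in> A \<Longrightarrow> D (p + q) = D p + D q"
    "p \<in> A \<Longrightarrow> D (cuv_const c * p) = cuv_const c * D p"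
    "p \<in> A \<Longrightarrow> q \<in> A \<Longrightarrow> D (p * q) = p * D q + q * D p"
    "p \<in> A \<Longrightarrow> D p \<in> B" "p \<notin> A \<Longrightarrow> D p = undefined"
  using assms by (auto simp: Der_def)

lemma Der_const:
  assumes "subalgebra A" "D \<in> Der A B"
  shows "D (cuv_const c) = 0"
proof -
  have "D (1 * 1) = D 1 + D 1"
    using DerD(3)[OF assms(2), of 1 1] subalgebra_1[OF assms(1)] by simp
  then have "D 1 = 0" by simp
  then show ?thesis
    using DerD(2)[OF assms(2), of 1 c] subalgebra_1[OF assms(1)] by simp
qed

lemma subalgebra_kernel:
  assumes "subalgebra A" "D \<in> Der A B"
  shows "subalgebra {p \<in> A. D p = 0}"
  using subalgebraD[OF assms(1)] DerD[OF assms(2)] Der_const[OF assms]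
  by (auto simp: subalgebra_def)

definition du :: "cuv \<Rightarrow> cuv"
  where "du = map_poly pderiv"

definition dv :: "cuv \<Rightarrow> cuv"
  where "dv = pderiv"

lemma du_add [simp]: "du (p + q) = du p + du q"
  unfolding du_def by (rule map_poly_add_hom) (simp_all add: pderiv_add)

lemma du_pCons: "du (pCons a p) = pCons (pderiv a) (du p)"
  by (rule poly_eqI) (simp add: du_def coeff_map_poly coeff_pCons split: nat.split)

lemma du_0 [simp]: "du 0 = 0"
  by (simp add: du_def)

lemma du_smult: "du (smult a q) = smult (pderiv a) q + smult a (du q)"
  by (rule poly_eqI) (simp add: du_def coeff_map_poly pderiv_mult algebra_simps)

lemma du_mult [simp]: "du (p * q) = p * du q + q * du p"
proof (induction p)
  case (pCons a p)
  have "pCons 0 (p * du q + q * du p) = pCons 0 (p * du q) + q * pCons 0 (du p)"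
    by simp
  then show ?case
    by (simp add: du_pCons du_smult pCons algebra_simps)
qed simp

lemma dv_add [simp]: "dv (p + q) = dv p + dv q"
  by (simp add: dv_def pderiv_add)

lemma dv_mult [simp]: "dv (p * q) = p * dv q + q * dv p"
  by (simp add: dv_def pderiv_mult)

lemma partials_of_generators [simp]:
  "du (cuv_const c) = 0" "du var_u = 1" "du var_v = 0"
  "dv (cuv_const c) = 0" "dv var_u = 0" "dv var_v = 1"
  by (simp_all add: cuv_const_def var_u_def var_v_def dv_def pderiv_pCons du_pCons one_pCons)

lemma partials_sum:
  "du (sum f I) = (\<Sum>i\<in>I. du (f i))" "dv (sum f I) = (\<Sum>i\<in>I. dv (f i))"
proof -
  have "dv 0 = 0" by (simp add: dv_def)
  then show "du (sum f I) = (\<Sum>i\<in>I. du (f i))" "dv (sum f I) = (\<Sum>i\<in>I. dv (f i))"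
    by (induction I rule: infinite_finite_induct) auto
qed

lemma vector_field_in_Der: "(\<lambda>p. a * du p + b * dv p) \<in> Der UNIV UNIV"
  by (simp add: Der_def algebra_simps)

lemma Der_eq_vector_field:
  assumes "D \<in> Der UNIV UNIV"
  shows "D p = D var_u * du p + D var_v * dv p"
  using DerD[OF assms] Der_const[OF subalgebra_UNIV assms]
  by (induction p rule: cuv_induct) (simp_all add: algebra_simps)

definition jac :: "cuv \<Rightarrow> cuv \<Rightarrow> cuv"
  where "jac f g = du f * dv g - dv f * du g"

section \<open>A derivation is determined by two functions with nonzero Jacobian\<close>

text \<open>
  In characteristic zero an element on which a derivation does not vanish is transcendental over
  the kernel: a relation \<open>P(f) = 0\<close> with constant coefficients differentiates to
  \<open>P'(f) D f = 0\<close>, so a nonzero relation of minimal degree is impossible.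
\<close>

lemma Der_relation_trivial:
  assumes A: "subalgebra A" and D: "D \<in> Der A B" and f: "f \<in> A" "D f \<noteq> 0"
    and a: "\<And>i. i \<le> N \<Longrightarrow> a i \<in> A" "\<And>i. i \<le> N \<Longrightarrow> D (a i) = 0"
    and rel: "(\<Sum>i\<le>N. a i * f ^ i) = 0" and "i \<le> N"
  shows "a i = 0"
proof -
  define K where "K = {p \<in> A. D p = 0}"
  have K: "subalgebra K"
    unfolding K_def by (rule subalgebra_kernel[OF A D])
  have chain: "poly P f \<in> A \<and> D (poly P f) = poly (pderiv P) f * D f"
    if "\<forall>i. coeff P i \<in> K" for P
    using that
  proof (induction P)
    case 0
    then show ?case using subalgebra_0[OF K] by (simp add: K_def)
  next
    case (pCons c P)
    have "coeff P i \<in> K" for i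
      using pCons.prems[rule_format, of "Suc i"] by simp
    then have IH: "poly P f \<in> A" "D (poly P f) = poly (pderiv P) f * D f"
      using pCons.IH by auto
    have c: "c \<in> A" "D c = 0"
      using pCons.prems[rule_format, of 0] by (auto simp: K_def)
    show ?case
      using IH c f(1) subalgebraD[OF A] DerD[OF D]
      by (simp add: pderiv_pCons algebra_simps)
  qed
  have no_relation: "poly P f \<noteq> 0" if "P \<noteq> 0" "\<forall>i. coeff P i \<in> K" for P
    using that
  proof (induction "degree P" arbitrary: P rule: less_induct)
    case less
    show ?case
    proof (cases "degree P = 0")
      case True
      then obtain c where "P = [:c:]" by (auto elim: degree_eq_zeroE)
      then show ?thesis using less.prems by auto
    next
      case False
      have "coeff (pderiv P) i \<in> K" for i
      proof -
        have "coeff (pderiv P) i = cuv_const (of_nat (Suc i)) * coeff P (Suc i)"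
          by (simp add: coeff_pderiv cuv_const_def of_nat_poly del: of_nat_Suc)
        then show ?thesis using subalgebraD[OF K] less.prems by metis
      qed
      moreover have "pderiv P \<noteq> 0" "degree (pderiv P) < degree P"
        using False by (auto simp: pderiv_eq_0_iff degree_pderiv)
      ultimately have "poly (pderiv P) f \<noteq> 0" using less.hyps by blast
      then have "D (poly P f) \<noteq> 0" using chain[of P] less.prems f(2) by auto
      moreover have "D 0 = 0" using subalgebra_0[OF K] by (auto simp: K_def)
      ultimately show ?thesis by auto
    qed
  qed
  define P where "P = (\<Sum>i\<le>N. monom (a i) i)"
  have coeff_P: "coeff P k = (if k \<le> N then a k else 0)" for k
    by (simp add: P_def coeff_sum)
  have "poly P f = 0"
    using rel by (simp add: P_def poly_sum poly_monom)
  moreover have "\<forall>i. coeff P i \<in> K"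
    using a subalgebra_0[OF K] by (auto simp: coeff_P K_def)
  ultimately have "P = 0" using no_relation by blast
  then show "a i = 0" using coeff_P[of i] \<open>i \<le> N\<close> by simp
qed

text \<open>
  The transcendence degree of \<open>\<complex>[u,v]\<close> is at most two, by counting dimensions: with exponents up to
  \<open>N\<close> there are \<open>(N+1)\<^sup>3\<close> monomials in \<open>f\<^sub>1, f\<^sub>2, f\<^sub>3\<close>, but they lie in a space of dimension
  \<open>O(N\<^sup>2)\<close>.
\<close>

lemma three_polynomials_dependent:
  fixes f1 f2 f3 :: cuv
  obtains N c i j k where "i \<le> N" "j \<le> N" "k \<le> N" "c i j k \<noteq> (0::complex)"
    "(\<Sum>i\<le>N. \<Sum>j\<le>N. \<Sum>k\<le>N. cuv_const (c i j k) * (f1 ^ i * f2 ^ j * f3 ^ k)) = 0"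
proof -
  interpret V: vector_space "\<lambda>c p. cuv_const c * p"
    by unfold_locales (simp_all add: algebra_simps)
  define mon where "mon = (\<lambda>(i, j). var_u ^ i * var_v ^ j)"
  define T where "T d = mon ` ({..d} \<times> {..d})" for d :: nat
  have mon_in_T: "var_u ^ i * var_v ^ j \<in> T d" if "i \<le> d" "j \<le> d" for i j d
  proof -
    have "mon (i, j) \<in> T d" unfolding T_def by (rule imageI) (simp add: that)
    then show ?thesis by (simp add: mon_def)
  qed
  have T_mult: "p * q \<in> T (a + b)" if "p \<in> T a" "q \<in> T b" for p q a b
  proof -
    from that(1) obtain x where x: "p = mon x" "x \<in> {..a} \<times> {..a}"
      unfolding T_def by (rule imageE)
    from that(2) obtain y where y: "q = mon y" "y \<in> {..b} \<times> {..b}"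
      unfolding T_def by (rule imageE)
    have "p * q = mon (fst x + fst y, snd x + snd y)"
      by (simp only: x y mon_def case_prod_unfold power_add fst_conv snd_conv mult_ac)
    moreover have "(fst x + fst y, snd x + snd y) \<in> {..a + b} \<times> {..a + b}"
      using x(2) y(2) by (simp add: mem_Times_iff add_mono)
    ultimately show ?thesis unfolding T_def by (rule image_eqI)
  qed
  have span_mult: "p * q \<in> V.span (T (a + b))" if p: "p \<in> V.span (T a)" and q: "q \<in> V.span (T b)"
    for p q a b
    using p
  proof (induction rule: V.span_induct_alt)
    case base
    show ?case by (simp add: V.span_zero)
  next
    case (step c x y)
    have "x * q \<in> V.span (T (a + b))"
      using q
    proof (induction rule: V.span_induct_alt)
      case base
      show ?case by (simp add: V.span_zero)
    next
      case (step d z w)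
      have "cuv_const d * (x * z) + x * w \<in> V.span (T (a + b))"
        using step \<open>x \<in> T a\<close> by (intro V.span_add V.span_scale) (auto intro: V.span_base T_mult)
      then show ?case by (simp add: algebra_simps)
    qed
    then have "cuv_const c * (x * q) + y * q \<in> V.span (T (a + b))"
      using step by (intro V.span_add V.span_scale)
    then show ?case by (simp add: algebra_simps)
  qed
  have T_mono: "V.span (T a) \<subseteq> V.span (T b)" if "a \<le> b" for a b
    using that by (intro V.span_mono) (auto simp: T_def)
  have T_1: "1 \<in> V.span (T a)" for a
    using mon_in_T[of 0 a 0] by (intro V.span_base) simp
  have in_some_span: "\<exists>d. p \<in> V.span (T d)" for p
  proof (induction p rule: cuv_induct)
    case (1 c)
    then show ?case using V.span_scale[OF T_1[of 0], of c] by auto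
  next
    case 2
    then show ?case using mon_in_T[of 1 1 0] by (intro exI[of _ 1] V.span_base) simp
  next
    case 3
    then show ?case using mon_in_T[of 0 1 1] by (intro exI[of _ 1] V.span_base) simp
  next
    case (4 p q)
    then obtain a b where "p \<in> V.span (T a)" "q \<in> V.span (T b)" by blast
    then have "p + q \<in> V.span (T (max a b))"
      using T_mono[of a "max a b"] T_mono[of b "max a b"] by (intro V.span_add) auto
    then show ?case ..
  next
    case (5 p q)
    then show ?case using span_mult by blast
  qed
  obtain d1 d2 d3 where "f1 \<in> V.span (T d1)" "f2 \<in> V.span (T d2)" "f3 \<in> V.span (T d3)"
    using in_some_span by meson
  then obtain d where f: "f1 \<in> V.span (T d)" "f2 \<in> V.span (T d)" "f3 \<in> V.span (T d)"
    using T_mono[of d1 "d1 + d2 + d3"] T_mono[of d2 "d1 + d2 + d3"]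
      T_mono[of d3 "d1 + d2 + d3"] by auto
  have span_power: "p ^ n \<in> V.span (T (d * n))" if "p \<in> V.span (T d)" for p n
    using that by (induction n) (auto simp: T_1 dest: span_mult)
  \<comment> \<open>This choice makes \<open>N + 1\<close> exceed \<open>(3d+1)\<^sup>2\<close>, hence \<open>(N+1)\<^sup>3 > ((3d+1)(N+1))\<^sup>2 \<ge> (3dN+1)\<^sup>2\<close>.\<close>
  define N where "N = (3 * d + 1)\<^sup>2"
  define M where "M = d * N + d * N + d * N"
  define I where "I = {..N} \<times> {..N} \<times> {..N}"
  define \<phi> where "\<phi> = (\<lambda>(i, j, k). f1 ^ i * f2 ^ j * f3 ^ k)"
  have \<phi>_span: "\<phi> ` I \<subseteq> V.span (T M)"
  proof -
    have "f1 ^ i * f2 ^ j * f3 ^ k \<in> V.span (T M)" if "i \<le> N" "j \<le> N" "k \<le> N" for i j k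
    proof -
      have "f1 ^ i * f2 ^ j * f3 ^ k \<in> V.span (T (d * i + d * j + d * k))"
        by (intro span_mult span_power f)
      moreover have "d * i + d * j + d * k \<le> M"
        unfolding M_def using that by (intro add_mono mult_le_mono2)
      ultimately show ?thesis using T_mono by blast
    qed
    then show ?thesis by (auto simp: \<phi>_def I_def)
  qed
  have "\<exists>c. (\<exists>x\<in>I. c x \<noteq> 0) \<and> (\<Sum>x\<in>I. cuv_const (c x) * \<phi> x) = 0"
  proof (cases "inj_on \<phi> I")
    case True
    have "card (T M) \<le> (M + 1)\<^sup>2"
      using card_image_le[of "{..M} \<times> {..M}" mon]
      by (simp add: T_def power2_eq_square)
    also have "\<dots> \<le> ((3 * d + 1) * (N + 1))\<^sup>2"
      by (intro power_mono) (simp_all add: M_def algebra_simps)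
    also have "\<dots> = N * (N + 1)\<^sup>2"
      by (simp only: N_def power_mult_distrib)
    also have "\<dots> < (N + 1) * (N + 1)\<^sup>2"
      by simp
    also have "\<dots> = card (\<phi> ` I)"
      using True by (simp add: card_image I_def power2_eq_square)
    finally have "V.dependent (\<phi> ` I)"
      using V.independent_span_bound[of "T M" "\<phi> ` I"] \<phi>_span by (auto simp: T_def)
    then obtain c where "\<exists>v\<in>\<phi> ` I. c v \<noteq> 0" "(\<Sum>v\<in>\<phi> ` I. cuv_const (c v) * v) = 0"
      using V.dependent_finite[of "\<phi> ` I"] by (auto simp: I_def)
    then show ?thesis
      using True by (intro exI[of _ "c \<circ> \<phi>"]) (auto simp: sum.reindex)
  next
    case False
    then obtain x y where xy: "x \<in> I" "y \<in> I" "x \<noteq> y" "\<phi> x = \<phi> y"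
      unfolding inj_on_def by blast
    define c :: "nat \<times> nat \<times> nat \<Rightarrow> complex"
      where "c z = (if z = x then 1 else if z = y then -1 else 0)" for z
    have "(\<Sum>z\<in>I. cuv_const (c z) * \<phi> z) = (\<Sum>z\<in>{x, y}. cuv_const (c z) * \<phi> z)"
      using xy by (intro sum.mono_neutral_right) (auto simp: I_def c_def)
    also have "\<dots> = 0"
    proof -
      have "cuv_const (- 1) = - 1" by (simp add: cuv_const_def one_pCons)
      then show ?thesis using xy by (simp add: c_def)
    qed
    finally show ?thesis
      using xy(1) by (intro exI[of _ c]) (auto simp: c_def)
  qed
  then obtain c x where "c x \<noteq> 0" "x \<in> I" "(\<Sum>x\<in>I. cuv_const (c x) * \<phi> x) = 0"
    by blast
  moreover obtain i j k where "x = (i, j, k)"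
    by (rule prod_cases3)
  ultimately show ?thesis
    by (intro that[of i N j k "\<lambda>i j k. c (i, j, k)"])
      (auto simp: I_def \<phi>_def sum.cartesian_product case_prod_unfold)
qed

text \<open>
  A nonzero Jacobian makes \<open>f1\<close>, \<open>f2\<close> algebraically independent, so in a relation between
  \<open>f\<close>, \<open>f1\<close>, \<open>f2\<close> the element \<open>f\<close> really occurs: it is algebraic over \<open>\<complex>[f1,f2]\<close>, on which \<open>D\<close>
  vanishes. Transcendence is detected three times by a derivation, first \<open>D\<close> for \<open>f\<close>, then
  \<open>J(f1, _)\<close> for \<open>f2\<close> over \<open>\<complex>[f1]\<close>, then \<open>\<partial>\<^sub>u\<close> or \<open>\<partial>\<^sub>v\<close> for \<open>f1\<close> over \<open>\<complex>\<close>.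
\<close>

lemma Der_eq_0_if_kills_pair:
  assumes A: "subalgebra A" and D: "D \<in> Der A B"
    and f: "f1 \<in> A" "f2 \<in> A" "D f1 = 0" "D f2 = 0" and jac: "jac f1 f2 \<noteq> 0"
    and "f \<in> A"
  shows "D f = 0"
proof (rule ccontr)
  assume nz: "D f \<noteq> 0"
  obtain N c i j k where ijk: "i \<le> N" "j \<le> N" "k \<le> N" and c: "c i j k \<noteq> (0::complex)"
    and rel: "(\<Sum>i\<le>N. \<Sum>j\<le>N. \<Sum>k\<le>N. cuv_const (c i j k) * (f1 ^ i * f2 ^ j * f ^ k)) = 0"
    by (rule three_polynomials_dependent)
  have "(\<Sum>k\<le>N. (\<Sum>j\<le>N. \<Sum>i\<le>N. cuv_const (c i j k) * (f1 ^ i * f2 ^ j)) * f ^ k) =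
      (\<Sum>k\<le>N. \<Sum>j\<le>N. \<Sum>i\<le>N. cuv_const (c i j k) * (f1 ^ i * f2 ^ j * f ^ k))"
    by (simp add: sum_distrib_right mult.assoc)
  also have "\<dots> = (\<Sum>j\<le>N. \<Sum>k\<le>N. \<Sum>i\<le>N. cuv_const (c i j k) * (f1 ^ i * f2 ^ j * f ^ k))"
    by (rule sum.swap)
  also have "\<dots> = (\<Sum>j\<le>N. \<Sum>i\<le>N. \<Sum>k\<le>N. cuv_const (c i j k) * (f1 ^ i * f2 ^ j * f ^ k))"
    by (rule sum.cong[OF refl], rule sum.swap)
  also have "\<dots> = (\<Sum>i\<le>N. \<Sum>j\<le>N. \<Sum>k\<le>N. cuv_const (c i j k) * (f1 ^ i * f2 ^ j * f ^ k))"
    by (rule sum.swap)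
  also have "\<dots> = 0"
    by (rule rel)
  finally have rel1: "(\<Sum>k\<le>N. (\<Sum>j\<le>N. \<Sum>i\<le>N. cuv_const (c i j k) * (f1 ^ i * f2 ^ j)) * f ^ k) = 0" .
  have coeffs: "(\<Sum>j\<le>N. \<Sum>i\<le>N. cuv_const (c i j k) * (f1 ^ i * f2 ^ j)) \<in> {p \<in> A. D p = 0}" for k
    using subalgebra_kernel[OF A D] f
    by (intro subalgebra_sum subalgebraD(3) subalgebraD(1) subalgebra_power) auto
  have "(\<Sum>j\<le>N. \<Sum>i\<le>N. cuv_const (c i j k) * (f1 ^ i * f2 ^ j)) = 0"
    by (rule Der_relation_trivial[OF A D \<open>f \<in> A\<close> nz _ _ rel1 ijk(3)]) (use coeffs in auto)
  then have rel2: "(\<Sum>j\<le>N. (\<Sum>i\<le>N. cuv_const (c i j k) * f1 ^ i) * f2 ^ j) = 0"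
    by (simp add: sum_distrib_right mult.assoc)
  define E where "E = (\<lambda>p. - dv f1 * du p + du f1 * dv p)"
  have E: "E \<in> Der UNIV UNIV"
    unfolding E_def by (rule vector_field_in_Der)
  have coeffs2: "(\<Sum>i\<le>N. cuv_const (c i j k) * f1 ^ i) \<in> {p \<in> UNIV. E p = 0}" for j
    using subalgebra_kernel[OF subalgebra_UNIV E]
    by (intro subalgebra_sum subalgebraD(3) subalgebraD(1) subalgebra_power) (auto simp: E_def)
  have rel3: "(\<Sum>i\<le>N. cuv_const (c i j k) * f1 ^ i) = 0"
    by (rule Der_relation_trivial[OF subalgebra_UNIV E _ _ _ _ rel2 ijk(2)])
      (use coeffs2 jac in \<open>auto simp: E_def jac_def algebra_simps\<close>)
  have "\<exists>F\<in>Der UNIV UNIV. F f1 \<noteq> 0"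
  proof (cases "du f1 = 0")
    case True
    then have "0 * du f1 + 1 * dv f1 \<noteq> 0" using jac by (auto simp: jac_def)
    then show ?thesis by (intro bexI[OF _ vector_field_in_Der])
  next
    case False
    then have "1 * du f1 + 0 * dv f1 \<noteq> 0" by simp
    then show ?thesis by (intro bexI[OF _ vector_field_in_Der])
  qed
  then obtain F where F: "F \<in> Der UNIV UNIV" "F f1 \<noteq> 0" by blast
  have "cuv_const (c i j k) = 0"
    by (rule Der_relation_trivial[OF subalgebra_UNIV F(1) _ F(2) _ _ rel3 ijk(1)])
      (use Der_const[OF subalgebra_UNIV F(1)] in auto)
  then show False using c by (simp add: cuv_const_def)
qed

section \<open>Jacobians of invariants have no common zero off the origin\<close>

definition eval_at :: "complex \<Rightarrow> complex \<Rightarrow> cuv \<Rightarrow> complex"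
  where "eval_at x y p = poly (poly p [:y:]) x"

lemma eval_at_simps [simp]:
  "eval_at x y 0 = 0" "eval_at x y 1 = 1"
  "eval_at x y (p + q) = eval_at x y p + eval_at x y q"
  "eval_at x y (p - q) = eval_at x y p - eval_at x y q"
  "eval_at x y (p * q) = eval_at x y p * eval_at x y q"
  "eval_at x y (cuv_const c) = c" "eval_at x y var_u = x" "eval_at x y var_v = y"
  by (simp_all add: eval_at_def cuv_const_def var_u_def var_v_def)

lemma eval_at_sum: "eval_at x y (sum f I) = (\<Sum>i\<in>I. eval_at x y (f i))"
  by (induction I rule: infinite_finite_induct) auto

lemma eval_at_prod: "eval_at x y (prod f I) = (\<Prod>i\<in>I. eval_at x y (f i))"
  by (induction I rule: infinite_finite_induct) auto

lemma act_generators: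
  "act g var_u = cuv_const (g$1$1) * var_u + cuv_const (g$2$1) * var_v"
  "act g var_v = cuv_const (g$1$2) * var_u + cuv_const (g$2$2) * var_v"
  by (simp_all add: act_def)

lemma eval_at_act:
  "eval_at x y (act g p) = eval_at (g$1$1 * x + g$2$1 * y) (g$1$2 * x + g$2$2 * y) p"
  by (induction p rule: cuv_induct) (simp_all add: act_generators)

lemma partials_act:
  "du (act g p) = cuv_const (g$1$1) * act g (du p) + cuv_const (g$1$2) * act g (dv p)"
  "dv (act g p) = cuv_const (g$2$1) * act g (du p) + cuv_const (g$2$2) * act g (dv p)"
proof -
  have "act g 0 = 0" "act g 1 = 1"
    using act_simps(3)[of g 0] act_simps(3)[of g 1] by auto
  then show
    "du (act g p) = cuv_const (g$1$1) * act g (du p) + cuv_const (g$1$2) * act g (dv p)"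
    "dv (act g p) = cuv_const (g$2$1) * act g (du p) + cuv_const (g$2$2) * act g (dv p)"
    by (induction p rule: cuv_induct) (simp_all add: act_generators algebra_simps)
qed

text \<open>
  An element \<open>g\<close> of determinant \<open>1\<close> with eigenvalue \<open>1\<close> has trace \<open>2\<close>, so \<open>(g - 1)\<^sup>2 = 0\<close> and
  \<open>g\<^sup>n = 1 + n (g - 1)\<close>. These powers are distinct unless \<open>g = 1\<close>.
\<close>

lemma finite_subgroup_acts_freely:
  assumes G: "subgroup G SL2C" "finite G" and g: "g \<in> G"
    and fixed: "g$1$1 * x + g$2$1 * y = x" "g$1$2 * x + g$2$2 * y = y"
    and nz: "x \<noteq> 0 \<or> y \<noteq> 0"
  shows "g = mat 1"
proof (rule ccontr)
  assume "g \<noteq> mat 1"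
  define a b c d where abcd: "a = g$1$1" "b = g$1$2" "c = g$2$1" "d = g$2$2"
  have "g \<in> carrier SL2C" using subgroup.subset[OF G(1)] g by auto
  then have det: "a * d - b * c = 1" by (simp add: SL2C_def det_2 abcd)
  have e1: "(a - 1) * x + c * y = 0" and e2: "b * x + (d - 1) * y = 0"
    using fixed by (simp_all add: abcd algebra_simps)
  have "((a - 1) * (d - 1) - b * c) * x = (d - 1) * ((a - 1) * x + c * y) - c * (b * x + (d - 1) * y)"
    by (simp add: algebra_simps)
  moreover have
    "((a - 1) * (d - 1) - b * c) * y = (a - 1) * (b * x + (d - 1) * y) - b * ((a - 1) * x + c * y)"
    by (simp add: algebra_simps)
  ultimately have "(a - 1) * (d - 1) - b * c = 0" using e1 e2 nz by auto
  then have d: "d = 2 - a" using det by (simp add: algebra_simps)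
  have bc: "b * (c * m) = 2 * a * m - m - a * (a * m)" for m
  proof -
    have "b * c = a * d - 1" by (simp flip: det)
    then have "(b * c) * m = (a * (2 - a) - 1) * m" by (simp add: d)
    then show ?thesis by (simp add: algebra_simps)
  qed
  define h :: "nat \<Rightarrow> complex^2^2"
    where "h n = (\<chi> i j. mat 1 $ i $ j + of_nat n * (g $ i $ j - mat 1 $ i $ j))" for n
  have h_Suc: "h (Suc n) = h n ** g" for n
    by (simp add: h_def vec_eq_iff forall_2 matrix_matrix_mult_def sum_2 mat_def flip: abcd)
      (simp add: bc d algebra_simps)
  have "h n \<in> G" for n
  proof (induction n)
    case 0
    have "h 0 = \<one>\<^bsub>SL2C\<^esub>" by (simp add: h_def SL2C_def vec_eq_iff)
    then show ?case using subgroup.one_closed[OF G(1)] by simp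
  next
    case (Suc n)
    then show ?case using subgroup.m_closed[OF G(1) Suc g] by (simp add: h_Suc SL2C_def)
  qed
  then have "finite (range h)" using G(2) by (meson finite_subset image_subsetI)
  moreover have "inj h"
  proof (rule injI)
    fix m n assume eq: "h m = h n"
    obtain i j where ij: "g $ i $ j \<noteq> mat 1 $ i $ j"
      using \<open>g \<noteq> mat 1\<close> by (auto simp: vec_eq_iff)
    have "h m $ i $ j = h n $ i $ j" by (simp add: eq)
    then show "m = n" using ij by (simp add: h_def)
  qed
  ultimately show False using finite_imageD by blast
qed

definition orbit_sum :: "(complex^2^2) set \<Rightarrow> cuv \<Rightarrow> cuv"
  where "orbit_sum G h = (\<Sum>g\<in>G. act g h)"

lemma orbit_sum_invariant:
  assumes G: "subgroup G SL2C"
  shows "orbit_sum G h \<in> invariants G"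
proof -
  have "act g (orbit_sum G h) = orbit_sum G h" if g: "g \<in> G" for g
  proof -
    interpret SL2C: group SL2C by (rule group_SL2C)
    interpret subgroup G SL2C by (rule G)
    have "act g 0 = 0" using act_simps(3)[of g 0] by simp
    then have act_sum: "act g (sum f I) = (\<Sum>i\<in>I. act g (f i))" for f and I :: "(complex^2^2) set"
      by (induction I rule: infinite_finite_induct) auto
    have bij: "bij_betw (\<lambda>k. g \<otimes>\<^bsub>SL2C\<^esub> k) G G"
      using g by (intro bij_betwI[where g = "\<lambda>k. inv\<^bsub>SL2C\<^esub> g \<otimes>\<^bsub>SL2C\<^esub> k"])
        (auto simp flip: SL2C.m_assoc)
    have "act g (orbit_sum G h) = (\<Sum>k\<in>G. act (g \<otimes>\<^bsub>SL2C\<^esub> k) h)"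
      by (simp add: orbit_sum_def act_sum SL2C_def act_mult)
    also have "\<dots> = orbit_sum G h"
      unfolding orbit_sum_def by (rule sum.reindex_bij_betw[OF bij])
    finally show ?thesis .
  qed
  then show ?thesis by (simp add: invariants_def)
qed

text \<open>
  If the gradient of \<open>h\<close> vanishes at every other point of the orbit of \<open>(x,y)\<close>, only the summand
  \<open>g = 1\<close> contributes to the gradient of the orbit sum at \<open>(x,y)\<close>.
\<close>

lemma gradient_orbit_sum:
  assumes G: "subgroup G SL2C" "finite G"
    and flat: "\<And>g. g \<in> G - {mat 1} \<Longrightarrow> eval_at x y (act g (du h)) = 0 \<and> eval_at x y (act g (dv h)) = 0"
  shows "eval_at x y (du (orbit_sum G h)) = eval_at x y (du h)"
    "eval_at x y (dv (orbit_sum G h)) = eval_at x y (dv h)"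
proof -
  have one: "mat 1 \<in> G" using subgroup.one_closed[OF G(1)] by (simp add: SL2C_def)
  have "eval_at x y (du (orbit_sum G h)) = (\<Sum>g\<in>G. eval_at x y (du (act g h)))"
    by (simp add: orbit_sum_def partials_sum eval_at_sum)
  also have "\<dots> = (\<Sum>g\<in>{mat 1}. eval_at x y (du (act g h)))"
    using G(2) one flat by (intro sum.mono_neutral_right) (auto simp: partials_act)
  finally show "eval_at x y (du (orbit_sum G h)) = eval_at x y (du h)" by (simp add: act_one)
  have "eval_at x y (dv (orbit_sum G h)) = (\<Sum>g\<in>G. eval_at x y (dv (act g h)))"
    by (simp add: orbit_sum_def partials_sum eval_at_sum)
  also have "\<dots> = (\<Sum>g\<in>{mat 1}. eval_at x y (dv (act g h)))"
    using G(2) one flat by (intro sum.mono_neutral_right) (auto simp: partials_act)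
  finally show "eval_at x y (dv (orbit_sum G h)) = eval_at x y (dv h)" by (simp add: act_one)
qed

text \<open>
  Invariants separate tangent directions at \<open>(x,y)\<close>: take orbit sums of \<open>(u - x) q\<^sup>2\<close> and
  \<open>(v - y) q\<^sup>2\<close>, where \<open>q\<close> vanishes on the rest of the orbit but not at \<open>(x,y)\<close>. Such a \<open>q\<close> exists
  because the action is free off the origin, and squaring it flattens the functions
  on the rest of the orbit.
\<close>

lemma jacobian_nonzero_at:
  assumes G: "subgroup G SL2C" "finite G" and nz: "x \<noteq> 0 \<or> y \<noteq> 0"
  obtains f1 f2 where "f1 \<in> invariants G" "f2 \<in> invariants G" "eval_at x y (jac f1 f2) \<noteq> 0"
proof -
  have "\<exists>L. eval_at x y L \<noteq> 0 \<and> eval_at x y (act g L) = 0" if g: "g \<in> G - {mat 1}" for g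
  proof -
    define x' y' where xy': "x' = g$1$1 * x + g$2$1 * y" "y' = g$1$2 * x + g$2$2 * y"
    have "x' \<noteq> x \<or> y' \<noteq> y"
      using finite_subgroup_acts_freely[OF G, of g x y] g nz by (auto simp: xy')
    then show ?thesis
    proof
      assume "x' \<noteq> x"
      then show ?thesis
        by (intro exI[of _ "var_u - cuv_const x'"]) (simp add: eval_at_act flip: xy')
    next
      assume "y' \<noteq> y"
      then show ?thesis
        by (intro exI[of _ "var_v - cuv_const y'"]) (simp add: eval_at_act flip: xy')
    qed
  qed
  then obtain L where L: "\<And>g. g \<in> G - {mat 1} \<Longrightarrow> eval_at x y (L g) \<noteq> 0"
    "\<And>g. g \<in> G - {mat 1} \<Longrightarrow> eval_at x y (act g (L g)) = 0"
    by metis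
  define q where "q = (\<Prod>g\<in>G - {mat 1}. L g)"
  have q: "eval_at x y q \<noteq> 0"
    using L(1) G(2) by (auto simp: q_def eval_at_prod)
  have q0: "eval_at x y (act g q) = 0" if "g \<in> G - {mat 1}" for g
    using L(2)[OF that] that G(2) by (auto simp: q_def eval_at_act eval_at_prod)
  define \<alpha> where "\<alpha> = var_u + cuv_const (- x)"
  define \<beta> where "\<beta> = var_v + cuv_const (- y)"
  have ev0: "eval_at x y \<alpha> = 0" "eval_at x y \<beta> = 0"
    by (simp_all add: \<alpha>_def \<beta>_def del: cuv_const_hom)
  have partials: "du \<alpha> = 1" "dv \<alpha> = 0" "du \<beta> = 0" "dv \<beta> = 1"
    by (simp_all add: \<alpha>_def \<beta>_def)
  have grad: "eval_at x y (du (orbit_sum G (l * (q * q)))) = eval_at x y (du l) * (eval_at x y q)\<^sup>2"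
    "eval_at x y (dv (orbit_sum G (l * (q * q)))) = eval_at x y (dv l) * (eval_at x y q)\<^sup>2"
    if "eval_at x y l = 0" for l
  proof -
    have "eval_at x y (act g (du (l * (q * q)))) = 0 \<and> eval_at x y (act g (dv (l * (q * q)))) = 0"
      if "g \<in> G - {mat 1}" for g
      using q0[OF that] by simp
    note grads = gradient_orbit_sum[OF G this]
    show "eval_at x y (du (orbit_sum G (l * (q * q)))) = eval_at x y (du l) * (eval_at x y q)\<^sup>2"
      by (subst grads(1)) (use that in \<open>simp_all add: power2_eq_square\<close>)
    show "eval_at x y (dv (orbit_sum G (l * (q * q)))) = eval_at x y (dv l) * (eval_at x y q)\<^sup>2"
      by (subst grads(2)) (use that in \<open>simp_all add: power2_eq_square\<close>)
  qed
  have "eval_at x y (jac (orbit_sum G (\<alpha> * (q * q))) (orbit_sum G (\<beta> * (q * q)))) \<noteq> 0"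
    using q by (simp add: jac_def grad ev0 partials)
  then show ?thesis
    by (intro that[OF orbit_sum_invariant[OF G(1)] orbit_sum_invariant[OF G(1)]])
qed

section \<open>Divisibility in the polynomial ring\<close>

text \<open>
  The prime factors of \<open>d\<close> can be cancelled from \<open>a\<close> one at a time, each by means of an element
  of \<open>S\<close> that it does not divide.
\<close>

lemma dvd_if_dvd_mult_all:
  fixes d :: "'a::factorial_semiring"
  assumes "d \<noteq> 0" "\<And>j. j \<in> S \<Longrightarrow> d dvd a * j"
    and "\<And>p. prime p \<Longrightarrow> \<exists>j\<in>S. \<not> p dvd j"
  shows "d dvd a"
  using assms(1,2)
proof (induction d arbitrary: a rule: prime_divisors_induct)
  case (factor p d)
  obtain j where j: "j \<in> S" "\<not> p dvd j" using assms(3) factor(1) by blast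
  have "p dvd a * j" using factor.prems(2)[OF j(1)] by (rule dvd_mult_left)
  then have "p dvd a" using j(2) factor(1) by (simp add: prime_dvd_mult_iff)
  then obtain b where b: "a = p * b" ..
  have "d dvd b"
  proof (rule factor.IH)
    show "d \<noteq> 0" using factor.prems by auto
    show "d dvd b * i" if "i \<in> S" for i
      using factor.prems(1) factor.prems(2)[OF that] by (auto simp: b mult.assoc)
  qed
  then show ?case by (simp add: b mult_dvd_mono)
qed auto

text \<open>
  A curve contains more than one point: a line \<open>u = x\<close> with \<open>x \<noteq> 0\<close> that avoids the zeros of the
  leading coefficient meets it, unless its equation does not involve \<open>v\<close>; in that case the curve
  contains an entire line \<open>u = x\<close>.
\<close>

lemma prime_has_zero_off_origin:
  fixes p :: cuv
  assumes "prime p"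
  obtains x y where "x \<noteq> 0 \<or> y \<noteq> 0" "eval_at x y p = 0"
proof (cases "degree p = 0")
  case True
  then obtain q where q: "p = [:q:]" by (auto elim: degree_eq_zeroE)
  have "\<not> is_unit p" using assms not_prime_unit by blast
  moreover have "q \<noteq> 0" using assms q by auto
  ultimately have "degree q \<noteq> 0"
    using is_unit_const_poly_iff[of q] by (auto simp: q is_unit_iff_degree)
  then have "\<not> constant (poly q)" by (simp add: constant_degree)
  then obtain x where "poly q x = 0" using fundamental_theorem_of_algebra by blast
  then have "eval_at x 1 p = 0" by (simp add: q eval_at_def)
  then show ?thesis by (rule that[rotated]) simp
next
  case False
  then have "lead_coeff p \<noteq> 0" by auto
  then have "finite {x. poly (lead_coeff p) x = 0}" by (rule poly_roots_finite)
  then have "finite (insert 0 {x. poly (lead_coeff p) x = 0})" by simp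
  from ex_new_if_finite[OF infinite_UNIV_char_0 this]
  obtain x where "x \<notin> insert 0 {x. poly (lead_coeff p) x = 0}" ..
  then have x: "x \<noteq> 0" "poly (lead_coeff p) x \<noteq> 0" by simp_all
  define r where "r = map_poly (\<lambda>q. poly q x) p"
  have "coeff r (degree p) \<noteq> 0" using x(2) by (simp add: r_def coeff_map_poly)
  then have "degree r \<noteq> 0" using False le_degree by fastforce
  then have "\<not> constant (poly r)" by (simp add: constant_degree)
  then obtain y where y: "poly r y = 0" using fundamental_theorem_of_algebra by blast
  have "eval_at x y s = poly (map_poly (\<lambda>q. poly q x) s) y" for s
    by (induction s) (simp_all add: eval_at_def map_poly_pCons)
  then have "eval_at x y p = 0" using y by (simp add: r_def)
  then show ?thesis using x(1) by (intro that[of x y]) auto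
qed

section \<open>Lifting derivations of the invariants\<close>

lemma exists_invariants_jac_nonzero:
  assumes "subgroup G SL2C" "finite G"
  obtains f1 f2 where "f1 \<in> invariants G" "f2 \<in> invariants G" "jac f1 f2 \<noteq> 0"
proof -
  obtain f1 f2 where "f1 \<in> invariants G" "f2 \<in> invariants G" "eval_at 1 0 (jac f1 f2) \<noteq> 0"
    by (rule jacobian_nonzero_at[OF assms, of 1 0]) auto
  then show ?thesis using that by force
qed

text \<open>
  The difference of two extensions is a vector field annihilating two invariants whose gradients
  are linearly independent at a generic point.
\<close>

lemma Der_eqI_on_invariants:
  assumes G: "subgroup G SL2C" "finite G"
    and D: "D \<in> Der UNIV UNIV" and E: "E \<in> Der UNIV UNIV"
    and eq: "\<And>f. f \<in> invariants G \<Longrightarrow> D f = E f"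
  shows "D = E"
proof
  fix p
  obtain f1 f2 where f: "f1 \<in> invariants G" "f2 \<in> invariants G" "jac f1 f2 \<noteq> 0"
    by (rule exists_invariants_jac_nonzero[OF G])
  define a where "a = D var_u - E var_u"
  define b where "b = D var_v - E var_v"
  have ab: "a * du h + b * dv h = D h - E h" for h
    by (subst Der_eq_vector_field[OF D], subst Der_eq_vector_field[OF E])
      (simp add: a_def b_def algebra_simps)
  then have e: "a * du f1 + b * dv f1 = 0" "a * du f2 + b * dv f2 = 0"
    using eq f by auto
  have "a * jac f1 f2 = dv f2 * (a * du f1 + b * dv f1) - dv f1 * (a * du f2 + b * dv f2)"
    "b * jac f1 f2 = du f1 * (a * du f2 + b * dv f2) - du f2 * (a * du f1 + b * dv f1)"
    by (simp_all add: jac_def algebra_simps)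
  then have "a = 0" "b = 0" using e f(3) by auto
  then show "D p = E p" using ab[of p] by simp
qed

text \<open>
  Cramer's rule, applied to a pair \<open>f1\<close>, \<open>f2\<close>, determines the only candidate for a lift. The
  defect of the candidate, cleared of denominators, is the derivation \<open>\<Delta>\<close> below; it kills \<open>f1\<close> and
  \<open>f2\<close>, hence every invariant.
\<close>

lemma Cramer_on_subalgebra:
  assumes A: "subalgebra A" and D: "D \<in> Der A B"
    and f: "f1 \<in> A" "f2 \<in> A" "jac f1 f2 \<noteq> 0" and "f \<in> A"
  shows "jac f1 f2 * D f =
    (D f1 * dv f2 - D f2 * dv f1) * du f + (D f2 * du f1 - D f1 * du f2) * dv f"
proof -
  define a where "a = D f1 * dv f2 - D f2 * dv f1"
  define b where "b = D f2 * du f1 - D f1 * du f2"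
  define \<Delta> where "\<Delta> = restrict (\<lambda>p. jac f1 f2 * D p - (a * du p + b * dv p)) A"
  have "\<Delta> \<in> Der A UNIV"
    using subalgebraD[OF A] DerD[OF D] Der_const[OF A D]
    by (auto simp: Der_def \<Delta>_def algebra_simps)
  moreover have "\<Delta> f1 = 0" "\<Delta> f2 = 0"
    using f by (simp_all add: \<Delta>_def a_def b_def jac_def algebra_simps)
  ultimately have "\<Delta> f = 0"
    using Der_eq_0_if_kills_pair[OF A] f \<open>f \<in> A\<close> by blast
  then show ?thesis using \<open>f \<in> A\<close> by (simp add: \<Delta>_def a_def b_def)
qed

text \<open>
  The coefficients of the lift are regular because their common denominator
  \<open>J(f1,f2)\<close> can be exchanged for \<open>J(p,q)\<close> with any other pair of invariants, and these
  denominators have no prime factor in common.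
\<close>

lemma Der_invariants_lifts:
  assumes G: "subgroup G SL2C" "finite G" and D: "D \<in> Der (invariants G) UNIV"
  obtains E where "E \<in> Der UNIV UNIV" "\<forall>f\<in>invariants G. E f = D f"
proof -
  obtain f1 f2 where f: "f1 \<in> invariants G" "f2 \<in> invariants G" "jac f1 f2 \<noteq> 0"
    by (rule exists_invariants_jac_nonzero[OF G])
  define a where "a = D f1 * dv f2 - D f2 * dv f1"
  define b where "b = D f2 * du f1 - D f1 * du f2"
  have D_eq: "jac f1 f2 * D h = a * du h + b * dv h" if "h \<in> invariants G" for h
    using Cramer_on_subalgebra[OF subalgebra_invariants D f that] by (simp add: a_def b_def)
  define S where "S = {jac p q |p q. p \<in> invariants G \<and> q \<in> invariants G}"
  have no_common_prime: "\<exists>j\<in>S. \<not> \<pi> dvd j" if "prime \<pi>" for \<pi>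
  proof -
    obtain x y where xy: "x \<noteq> 0 \<or> y \<noteq> 0" "eval_at x y \<pi> = 0"
      using \<open>prime \<pi>\<close> by (rule prime_has_zero_off_origin)
    obtain p q where pq: "p \<in> invariants G" "q \<in> invariants G" "eval_at x y (jac p q) \<noteq> 0"
      by (rule jacobian_nonzero_at[OF G xy(1)])
    have "\<not> \<pi> dvd jac p q" using pq(3) xy(2) by (auto elim!: dvdE)
    then show ?thesis using pq by (auto simp: S_def)
  qed
  have "jac f1 f2 dvd a * jac p q" "jac f1 f2 dvd b * jac p q"
    if pq: "p \<in> invariants G" "q \<in> invariants G" for p q
  proof -
    have cramer: "a * jac p q = dv q * (a * du p + b * dv p) - dv p * (a * du q + b * dv q)"
      "b * jac p q = du p * (a * du q + b * dv q) - du q * (a * du p + b * dv p)"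
      by (simp_all add: jac_def algebra_simps)
    have "a * jac p q = jac f1 f2 * (dv q * D p - dv p * D q)"
      "b * jac p q = jac f1 f2 * (du p * D q - du q * D p)"
      unfolding cramer D_eq[OF pq(1), symmetric] D_eq[OF pq(2), symmetric]
      by (simp_all add: algebra_simps)
    then show "jac f1 f2 dvd a * jac p q" "jac f1 f2 dvd b * jac p q" by auto
  qed
  then have "jac f1 f2 dvd a * j" "jac f1 f2 dvd b * j" if "j \<in> S" for j
    using that unfolding S_def by blast+
  then have "jac f1 f2 dvd a" "jac f1 f2 dvd b"
    using dvd_if_dvd_mult_all[OF f(3) _ no_common_prime] by blast+
  then obtain a' b' where ab': "a = jac f1 f2 * a'" "b = jac f1 f2 * b'"
    by (auto elim!: dvdE)
  show ?thesis
  proof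
    show "(\<lambda>p. a' * du p + b' * dv p) \<in> Der UNIV UNIV" by (rule vector_field_in_Der)
    show "\<forall>h\<in>invariants G. a' * du h + b' * dv h = D h"
    proof
      fix h assume h: "h \<in> invariants G"
      have "jac f1 f2 * (a' * du h + b' * dv h) = jac f1 f2 * D h"
        by (simp only: D_eq[OF h] ab') (simp add: algebra_simps)
      then show "a' * du h + b' * dv h = D h" using f(3) by simp
    qed
  qed
qed

lemma Der_restrict:
  assumes "subalgebra A" "D \<in> Der UNIV UNIV" "\<And>f. f \<in> A \<Longrightarrow> D f \<in> B"
  shows "restrict D A \<in> Der A B"
  using assms(3) subalgebraD[OF assms(1)] DerD[OF assms(2)]
    Der_const[OF subalgebra_UNIV assms(2)]
  by (auto simp: Der_def)

section \<open>Equivariance\<close>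

lemma Der_conjugate:
  assumes D: "D \<in> Der UNIV UNIV" and gh: "g ** h = mat 1"
  shows "act g \<circ> D \<circ> act h \<in> Der UNIV UNIV"
proof -
  have "act g (act h p) = p" for p
    by (simp add: gh act_one flip: act_mult)
  then show ?thesis
    using DerD[OF D] Der_const[OF subalgebra_UNIV D] by (simp add: Der_def)
qed

lemma SL2C_inverse:
  assumes "g \<in> carrier SL2C"
  shows "g ** inv\<^bsub>SL2C\<^esub> g = mat 1"
  using group.r_inv[OF group_SL2C assms] by (simp add: SL2C_def)

theorem theorem4p1:
  fixes G1 G2 :: "(complex^2^2) set"
  assumes "subgroup G1 SL2C" and "finite G1"
    and "subgroup G2 SL2C" and "finite G2"
    and "G1 \<subseteq> G2"
  shows "let r = (\<lambda>D. restrict D (invariants G2)) in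
    bij_betw r (Der UNIV UNIV) (Der (invariants G2) UNIV) \<and>
    {D \<in> Der UNIV UNIV. r D \<in> Der (invariants G2) (invariants G1)} =
      {D \<in> Der UNIV UNIV. equivariant G1 D}"
proof -
  let ?R = "invariants G2"
  have bij: "bij_betw (\<lambda>D. restrict D ?R) (Der UNIV UNIV) (Der ?R UNIV)"
  proof (rule bij_betw_imageI)
    show "inj_on (\<lambda>D. restrict D ?R) (Der UNIV UNIV)"
    proof (rule inj_onI)
      fix D E
      assume DE: "D \<in> Der UNIV UNIV" "E \<in> Der UNIV UNIV" and eq: "restrict D ?R = restrict E ?R"
      have "D f = E f" if "f \<in> ?R" for f
        using fun_cong[OF eq, of f] that by simp
      then show "D = E"
        using Der_eqI_on_invariants[OF assms(3,4) DE] by blast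
    qed
    show "(\<lambda>D. restrict D ?R) ` Der UNIV UNIV = Der ?R UNIV"
    proof (intro equalityI subsetI)
      fix D assume "D \<in> (\<lambda>D. restrict D ?R) ` Der UNIV UNIV"
      then show "D \<in> Der ?R UNIV" by (auto intro: Der_restrict subalgebra_invariants)
    next
      fix D assume D: "D \<in> Der ?R UNIV"
      obtain E where E: "E \<in> Der UNIV UNIV" "\<forall>f\<in>?R. E f = D f"
        by (rule Der_invariants_lifts[OF assms(3,4) D])
      have "D = restrict E ?R" using E(2) DerD(5)[OF D] by (auto simp: restrict_def)
      then show "D \<in> (\<lambda>D. restrict D ?R) ` Der UNIV UNIV" using E(1) by blast
    qed
  qed
  have "restrict D ?R \<in> Der ?R (invariants G1) \<longleftrightarrow> equivariant G1 D"
    if D: "D \<in> Der UNIV UNIV" for D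
  proof -
    have conj_on_R: "(act g \<circ> D \<circ> act (inv\<^bsub>SL2C\<^esub> g)) f = act g (D f)"
      if "g \<in> G1" "f \<in> ?R" for g f
      using that assms(5) subgroup.m_inv_closed[OF assms(3), of g] by (auto simp: invariants_def)
    show ?thesis
    proof
      assume r: "restrict D ?R \<in> Der ?R (invariants G1)"
      show "equivariant G1 D"
        unfolding equivariant_def
      proof
        fix g assume g: "g \<in> G1"
        have "g \<in> carrier SL2C" using g subgroup.subset[OF assms(1)] by auto
        then have "act g \<circ> D \<circ> act (inv\<^bsub>SL2C\<^esub> g) \<in> Der UNIV UNIV"
          by (intro Der_conjugate D SL2C_inverse)
        moreover have "(act g \<circ> D \<circ> act (inv\<^bsub>SL2C\<^esub> g)) f = D f" if f: "f \<in> ?R" for f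
          using conj_on_R[OF g f] DerD(4)[OF r f] f g by (simp add: invariants_def)
        ultimately show "act g \<circ> D \<circ> act (inv\<^bsub>SL2C\<^esub> g) = D"
          by (rule Der_eqI_on_invariants[OF assms(3,4) _ D])
      qed
    next
      assume eq: "equivariant G1 D"
      show "restrict D ?R \<in> Der ?R (invariants G1)"
      proof (rule Der_restrict[OF subalgebra_invariants D])
        fix f assume f: "f \<in> ?R"
        have "act g (D f) = D f" if g: "g \<in> G1" for g
        proof -
          have "act g \<circ> D \<circ> act (inv\<^bsub>SL2C\<^esub> g) = D"
            using eq g by (simp add: equivariant_def)
          then show ?thesis using conj_on_R[OF g f] by simp
        qed
        then show "D f \<in> invariants G1" by (simp add: invariants_def)
      qed
    qed
  qed
  then show ?thesis using bij by (auto simp: Let_def)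
qed

end
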